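(* Let $0<q<1$ and $\nu>-1$ be fixed, and let $j_{1\nu}<j_{2\nu}<\cdots$ be the positive zeros of $z\mapsto J_\nu(z;q^2)$. Then, for all sufficiently large positive integers $k$, $$j_{k-1,\nu}<q\,j_{k\nu}<q^{-k+1}.$$
   Context: For $0<p<1$: $(a;p)_0=1$, $(a;p)_n=\prod_{i=0}^{n-1}(1-ap^i)$, $(a;p)_\infty=\lim_{n\to\infty}(a;p)_n$. The third Jackson (Hahn--Exton) $q$-Bessel function, with base $q^2$, is defined for $z>0$ by $$J_{\nu}(z;q^2)=z^{\nu}\frac{(q^{2(\nu+1)};q^2)_\infty}{(q^2;q^2)_\infty}\sum_{k=0}^{\infty}(-1)^k\frac{q^{k(k+1)}}{(q^{2(\nu+1)};q^2)_k\,(q^2;q^2)_k}z^{2k}.$$ It is known that for $\nu>-1$ its positive zeros form a countably infinite set of simple zeros, which can be listed in increasing order $j_{1\nu}<j_{2\nu}<\cdots$; $j_{k-1,\nu}$ denotes the $(k-1)$-th one. *)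

theory Defs
  imports Complex_Main
begin

definition qpoch :: "real \<Rightarrow> real \<Rightarrow> nat \<Rightarrow> real" where
  "qpoch a p n = (\<Prod>i<n. 1 - a * p ^ i)"

definition qpoch_inf :: "real \<Rightarrow> real \<Rightarrow> real" where
  "qpoch_inf a p = lim (\<lambda>n. qpoch a p n)"

(* The third Jackson (Hahn-Exton) q-Bessel function J_nu(z; q^2), for z > 0.
   The argument q is the square root of the base: the base itself is q^2. *)
definition hahn_exton_J :: "real \<Rightarrow> real \<Rightarrow> real \<Rightarrow> real" where
  "hahn_exton_J \<nu> q z =
     z powr \<nu> * (qpoch_inf (q powr (2 * (\<nu> + 1))) (q\<^sup>2) / qpoch_inf (q\<^sup>2) (q\<^sup>2)) *
     (\<Sum>k. (-1) ^ k *
          (q ^ (k * (k + 1)) / (qpoch (q powr (2 * (\<nu> + 1))) (q\<^sup>2) k * qpoch (q\<^sup>2) (q\<^sup>2) k)) *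
          z ^ (2 * k))"

end

theory Submission
  imports Defs "HOL-Analysis.Analysis"
begin

text \<open>
  Put \<open>p = q\<^sup>2\<close>, \<open>a = q powr (2\<nu> + 2)\<close> and \<open>x = z\<^sup>2\<close>. Up to a positive factor, the Bessel function
  is an entire function \<open>F\<^sub>a(x)\<close> with \<open>0 < a < 1\<close>, and in terms of its positive zeros
  \<open>x\<^sub>1 < x\<^sub>2 < \<dots>\<close> the claim reads \<open>x\<^bsub>k-1\<^esub> < p x\<^sub>k\<close> and \<open>x\<^sub>k < p\<^bsup>-k\<^esup>\<close>. Both are shown for
  every \<open>k \<ge> 2\<close>, without asymptotics of the zeros.

  \<^emph>\<open>Spacing.\<close> \<open>F = F\<^sub>a\<close> satisfies \<open>F(x) = (1 + a/p - p x) F(p x) - (a/p) F(p\<^sup>2 x)\<close>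
  (\<open>series_functional_equation\<close>). Differentiating, the Wronskian \<open>W\<close> of \<open>F(x)\<close> and \<open>F(p x)\<close> obeys
  \<open>W(x) = a W(p x) - p F(p x)\<^sup>2\<close>, which forces \<open>W < 0\<close> (\<open>scaled_wronskian_neg\<close>). So \<open>F(x) / F(p x)\<close>
  decreases wherever it is defined, and cannot vanish twice unless \<open>F(p x)\<close> vanishes in between:
  there is a zero of \<open>F\<close> in \<open>(p x\<^sub>k, p x\<^bsub>k+1\<^esub>)\<close>. By induction this zero is at least \<open>x\<^sub>k\<close>, whence
  \<open>x\<^sub>k < p x\<^bsub>k+1\<^esub>\<close> (\<open>enumerated_zeros_spacing\<close>).

  \<^emph>\<open>Upper bound.\<close> From \<open>(1 - a) F\<^sub>a(x) = F\<^bsub>ap\<^esub>(x) - a F\<^bsub>ap\<^esub>(p x)\<close> and the same monotonicity, every zero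
  of \<open>F\<^bsub>ap\<^esub>\<close> has its own zero of \<open>F\<^sub>a\<close> to its left (\<open>interlacing_zero\<close>), so \<open>F\<^sub>a\<close> has at least as many zeros
  below any bound as \<open>F\<^bsub>ap\<^esub>\<close>, and by iteration as many as \<open>F\<^sub>b\<close> with \<open>b = a p\<^sup>m\<close>. As \<open>m\<close> grows, \<open>F\<^sub>b\<close>
  tends to \<open>F\<^sub>0\<close>, the infinite product of the factors \<open>1 - p\<^sup>i x\<close> with \<open>i \<ge> 1\<close>, whose zeros are exactly
  \<open>p\<^bsup>-1\<^esup>, p\<^bsup>-2\<^esup>, \<dots>\<close>. Comparing signs at points slightly beyond these zeros gives \<open>x\<^sub>k \<le> p\<^bsup>-k\<^esup>\<close>
  (\<open>enumerated_zeros_upper_bound\<close>), and the spacing turns this into a strict inequality: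
  \<open>x\<^sub>k < p x\<^bsub>k+1\<^esub> \<le> p\<^bsup>-k\<^esup>\<close>.
\<close>

section \<open>The entire function behind the Bessel function\<close>

definition hahn_exton_coeff :: "real \<Rightarrow> real \<Rightarrow> nat \<Rightarrow> real" where
  "hahn_exton_coeff p a k = (-1) ^ k * p ^ (k * (k + 1) div 2) / (qpoch a p k * qpoch p p k)"

definition hahn_exton_series :: "real \<Rightarrow> real \<Rightarrow> real \<Rightarrow> real" where
  "hahn_exton_series p a x = (\<Sum>k. hahn_exton_coeff p a k * x ^ k)"

definition hahn_exton_series_deriv :: "real \<Rightarrow> real \<Rightarrow> real \<Rightarrow> real" where
  "hahn_exton_series_deriv p a x = (\<Sum>k. diffs (hahn_exton_coeff p a) k * x ^ k)"

lemma qpoch_Suc: "qpoch a p (Suc n) = qpoch a p n * (1 - a * p ^ n)"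
  by (simp add: qpoch_def)

context
  fixes p :: real
  assumes p_pos: "0 < p" and p_less_1: "p < 1"
begin

lemma qpoch_factor_pos:
  assumes "a < 1"
  shows "0 < 1 - a * p ^ k"
proof -
  have pk: "0 < p ^ k" "p ^ k \<le> 1"
    using p_pos p_less_1 by (auto intro: power_le_one)
  have "a * p ^ k < 1 * p ^ k"
    using assms pk by (intro mult_strict_right_mono)
  with pk show ?thesis by linarith
qed

lemma qpoch_pos: "a < 1 \<Longrightarrow> 0 < qpoch a p k"
  unfolding qpoch_def by (intro prod_pos qpoch_factor_pos)

lemma qpoch_inf_pos:
  assumes "a < 1"
  shows "qpoch_inf a p > 0"
proof -
  note fac = qpoch_factor_pos[OF assms]
  have "summable (\<lambda>i. norm ((1 - a * p ^ i) - 1))"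
    using p_pos p_less_1 by (simp add: abs_mult summable_mult)
  then have conv: "convergent_prod (\<lambda>i. 1 - a * p ^ i)"
    by (intro abs_convergent_prod_imp_convergent_prod summable_imp_abs_convergent_prod)
  have nz: "prodinf (\<lambda>i. 1 - a * p ^ i) \<noteq> 0"
    using conv fac by (intro prodinf_nonzero) (auto simp: less_imp_neq[symmetric])
  have "(\<lambda>n. \<Prod>i\<le>n. 1 - a * p ^ i) \<longlonglongrightarrow> prodinf (\<lambda>i. 1 - a * p ^ i)"
    using conv by (rule convergent_prod_LIMSEQ)
  then have "(\<lambda>n. qpoch a p (Suc n)) \<longlonglongrightarrow> prodinf (\<lambda>i. 1 - a * p ^ i)"
    by (simp add: qpoch_def lessThan_Suc_atMost)
  then have lim: "(\<lambda>n. qpoch a p n) \<longlonglongrightarrow> prodinf (\<lambda>i. 1 - a * p ^ i)"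
    by (simp only: filterlim_sequentially_Suc)
  have "qpoch a p n \<ge> 0" for n
    unfolding qpoch_def by (intro prod_nonneg ballI less_imp_le fac)
  then have "prodinf (\<lambda>i. 1 - a * p ^ i) \<ge> 0"
    by (intro LIMSEQ_le_const[OF lim]) auto
  with nz lim show ?thesis
    unfolding qpoch_inf_def by (simp add: limI)
qed

lemma coeff_0 [simp]: "hahn_exton_coeff p a 0 = 1"
  by (simp add: hahn_exton_coeff_def qpoch_def)

lemma coeff_Suc:
  assumes "a < 1"
  shows "(1 - a * p ^ k) * (1 - p ^ Suc k) * hahn_exton_coeff p a (Suc k)
           = - (p ^ Suc k) * hahn_exton_coeff p a k"
proof -
  have "Suc k * (Suc k + 1) div 2 = k * (k + 1) div 2 + Suc k"
    by (simp add: algebra_simps)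
  moreover have "1 - a * p ^ k \<noteq> 0" "1 - p * p ^ k \<noteq> 0"
    using qpoch_factor_pos[OF assms, of k] qpoch_factor_pos[OF p_less_1, of k] by auto
  moreover have "qpoch a p k \<noteq> 0" "qpoch p p k \<noteq> 0"
    using qpoch_pos[OF assms, of k] qpoch_pos[OF p_less_1, of k] by auto
  ultimately show ?thesis
    unfolding hahn_exton_coeff_def
    by (simp only: qpoch_Suc power_add) (simp add: divide_simps)
qed

lemma coeff_shift:
  assumes "a < 1"
  shows "(1 - a * p ^ k) * hahn_exton_coeff p (a * p) k = (1 - a) * hahn_exton_coeff p a k"
proof -
  have "qpoch (a * p) p k * (1 - a) = qpoch a p k * (1 - a * p ^ k)"
  proof (induction k)
    case (Suc k)
    have "qpoch (a * p) p (Suc k) * (1 - a) = (qpoch (a * p) p k * (1 - a)) * (1 - a * p ^ Suc k)"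
      by (simp add: qpoch_Suc mult_ac)
    then show ?case by (simp only: Suc.IH) (simp only: qpoch_Suc mult_ac)
  qed (simp add: qpoch_def)
  moreover have "a * p < 1"
    using qpoch_factor_pos[OF assms, of 1] by simp
  then have "qpoch (a * p) p k > 0" "qpoch a p k > 0" "qpoch p p k > 0"
    using qpoch_pos assms p_less_1 by auto
  ultimately show ?thesis
    unfolding hahn_exton_coeff_def by (simp add: divide_simps) (simp add: algebra_simps)
qed

lemma summable_series:
  assumes "a < 1"
  shows "summable (\<lambda>k. hahn_exton_coeff p a k * x ^ k)"
proof -
  let ?c = "hahn_exton_coeff p a"
  \<comment> \<open>\<open>?B\<close> bounds the denominator of the coefficient ratio from below, uniformly in \<open>k\<close>.\<close>
  let ?B = "(1 - max 0 a) * (1 - p)"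
  have B: "?B > 0" using assms p_less_1 by auto
  have "(\<lambda>k. p ^ Suc k * \<bar>x\<bar> / ?B) \<longlonglongrightarrow> 0 * \<bar>x\<bar> / ?B"
    using p_pos p_less_1 by (intro tendsto_intros LIMSEQ_Suc LIMSEQ_power_zero) (use B in auto)
  then have "eventually (\<lambda>k. p ^ Suc k * \<bar>x\<bar> / ?B < 1/2) sequentially"
    by (intro order_tendstoD) auto
  then obtain N where N: "\<And>k. k \<ge> N \<Longrightarrow> p ^ Suc k * \<bar>x\<bar> / ?B < 1/2"
    by (auto simp: eventually_sequentially)
  show ?thesis
  proof (rule summable_ratio_test[of "1/2" N])
    fix k assume "N \<le> k"
    have pk: "0 < p ^ k" "p ^ k \<le> 1"
      using p_pos p_less_1 by (auto intro: power_le_one)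
    have "a * p ^ k \<le> max 0 a * p ^ k" using pk by (intro mult_right_mono) auto
    also have "\<dots> \<le> max 0 a * 1" using pk by (intro mult_left_mono) auto
    finally have 1: "1 - max 0 a \<le> 1 - a * p ^ k" by simp
    have 2: "1 - p \<le> 1 - p ^ Suc k"
      using pk p_pos by (simp add: mult_left_le)
    have B_le: "?B \<le> (1 - a * p ^ k) * (1 - p ^ Suc k)"
      using 1 2 assms p_less_1 by (intro mult_mono) auto
    have "?B * \<bar>?c (Suc k)\<bar> \<le> (1 - a * p ^ k) * (1 - p ^ Suc k) * \<bar>?c (Suc k)\<bar>"
      using B_le by (intro mult_right_mono) auto
    also have "\<dots> = \<bar>(1 - a * p ^ k) * (1 - p ^ Suc k) * ?c (Suc k)\<bar>"
      using B B_le by (subst abs_mult, subst abs_of_pos) auto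
    also have "\<dots> = p ^ Suc k * \<bar>?c k\<bar>"
      using coeff_Suc[OF assms, of k] p_pos by (simp add: abs_mult)
    finally have "\<bar>?c (Suc k)\<bar> \<le> p ^ Suc k / ?B * \<bar>?c k\<bar>"
      using B by (simp add: field_simps)
    then have "\<bar>?c (Suc k)\<bar> * (\<bar>x\<bar> * \<bar>x\<bar> ^ k) \<le> p ^ Suc k / ?B * \<bar>?c k\<bar> * (\<bar>x\<bar> * \<bar>x\<bar> ^ k)"
      by (rule mult_right_mono) simp
    also have "\<dots> = (p ^ Suc k * \<bar>x\<bar> / ?B) * (\<bar>?c k\<bar> * \<bar>x\<bar> ^ k)" by simp
    also have "\<dots> \<le> 1/2 * (\<bar>?c k\<bar> * \<bar>x\<bar> ^ k)"
      using N[OF \<open>N \<le> k\<close>] by (intro mult_right_mono) auto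
    finally show "norm (?c (Suc k) * x ^ Suc k) \<le> 1/2 * norm (?c k * x ^ k)"
      by (simp add: abs_mult power_abs)
  qed simp
qed

lemma series_sums:
  "a < 1 \<Longrightarrow> (\<lambda>k. hahn_exton_coeff p a k * x ^ k) sums hahn_exton_series p a x"
  unfolding hahn_exton_series_def by (intro summable_sums summable_series)

lemma series_0 [simp]: "hahn_exton_series p a 0 = 1"
  by (simp add: hahn_exton_series_def powser_zero)

lemma series_deriv_0: "hahn_exton_series_deriv p a 0 = hahn_exton_coeff p a 1"
  by (simp add: hahn_exton_series_deriv_def powser_zero diffs_def)

lemma DERIV_series:
  "a < 1 \<Longrightarrow> (hahn_exton_series p a has_real_derivative hahn_exton_series_deriv p a x) (at x)"
  unfolding hahn_exton_series_def[abs_def] hahn_exton_series_deriv_def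
  by (rule termdiffs_strong_converges_everywhere) (simp add: summable_series)

lemma continuous_on_series: "a < 1 \<Longrightarrow> continuous_on S (hahn_exton_series p a)"
  by (meson DERIV_continuous_on DERIV_series has_field_derivative_at_within)

lemma continuous_on_series_scaled: "a < 1 \<Longrightarrow> continuous_on S (\<lambda>x. hahn_exton_series p a (b * x))"
  by (intro continuous_on_compose2[OF continuous_on_series[of a UNIV]] continuous_intros) auto

lemma isCont_series_deriv: "a < 1 \<Longrightarrow> isCont (hahn_exton_series_deriv p a) x"
  unfolding hahn_exton_series_deriv_def[abs_def]
  by (intro isCont_powser_converges_everywhere termdiff_converges_all) (simp add: summable_series)

lemma DERIV_series_scaled:
  assumes "a < 1"
  shows "((\<lambda>x. hahn_exton_series p a (b * x)) has_real_derivative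
            b * hahn_exton_series_deriv p a (b * x)) (at x)"
proof -
  have "((\<lambda>x. b * x) has_real_derivative b) (at x)"
    by (auto intro!: derivative_eq_intros)
  from DERIV_chain2[OF DERIV_series[OF assms] this] show ?thesis
    by (simp only: mult.commute[of b "hahn_exton_series_deriv p a (b * x)"])
qed

text \<open>The coefficient recursion contains \<open>(1 - a p\<^sup>k) (1 - p\<^bsup>k+1\<^esup>)\<close>, a polynomial in \<open>p\<^sup>k\<close>; multiplying
  the \<open>k\<close>-th coefficient by \<open>p\<^sup>k\<close> is scaling the argument by \<open>p\<close>.\<close>

lemma series_functional_equation:
  assumes "a < 1"
  shows "hahn_exton_series p a x =
    (1 + a / p - p * x) * hahn_exton_series p a (p * x) - a / p * hahn_exton_series p a (p\<^sup>2 * x)"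
proof -
  let ?c = "hahn_exton_coeff p a" and ?F = "hahn_exton_series p a"
  have "(\<lambda>k. ?c k * x ^ k - (1 + a / p) * (?c k * (p * x) ^ k) + a / p * (?c k * (p\<^sup>2 * x) ^ k))
          sums (?F x - (1 + a / p) * ?F (p * x) + a / p * ?F (p\<^sup>2 * x))" (is "?t sums ?L")
    by (intro sums_add sums_diff sums_mult series_sums assms)
  moreover have "?t sums (- (p * x) * ?F (p * x))"
  proof -
    have "?t (Suc k) = - (p * x) * (?c k * (p * x) ^ k)" for k
    proof -
      have "?t (Suc k) = ((1 - a * p ^ k) * (1 - p ^ Suc k) * ?c (Suc k)) * x ^ Suc k"
        using p_pos by (simp add: field_simps power2_eq_square)
      also have "\<dots> = - (p * x) * (?c k * (p * x) ^ k)"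
        by (subst coeff_Suc[OF assms]) (simp add: power_mult_distrib)
      finally show ?thesis .
    qed
    then have "(\<lambda>k. ?t (Suc k)) sums (- (p * x) * ?F (p * x))"
      by (simp only:) (intro sums_mult series_sums assms)
    then show ?thesis by (subst (asm) sums_Suc_iff) simp
  qed
  ultimately have "?L = - (p * x) * ?F (p * x)"
    by (rule sums_unique2)
  then show ?thesis by (simp add: algebra_simps)
qed

text \<open>Since \<open>(ap; p)\<^sub>k = (a; p)\<^sub>k (1 - a p\<^sup>k) / (1 - a)\<close>, passing from \<open>ap\<close> to \<open>a\<close> costs a factor
  \<open>1 - a p\<^sup>k\<close> per coefficient, which is again a scaling of the argument.\<close>

lemma series_shift_parameter:
  assumes "a < 1"
  shows "(1 - a) * hahn_exton_series p a x
    = hahn_exton_series p (a * p) x - a * hahn_exton_series p (a * p) (p * x)"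
proof -
  have "a * p < 1" using qpoch_factor_pos[OF assms, of 1] by simp
  then have "(\<lambda>k. hahn_exton_coeff p (a * p) k * x ^ k - a * (hahn_exton_coeff p (a * p) k * (p * x) ^ k))
     sums (hahn_exton_series p (a * p) x - a * hahn_exton_series p (a * p) (p * x))"
    by (intro sums_diff sums_mult series_sums)
  moreover have "hahn_exton_coeff p (a * p) k * x ^ k - a * (hahn_exton_coeff p (a * p) k * (p * x) ^ k)
      = (1 - a) * (hahn_exton_coeff p a k * x ^ k)" for k
  proof -
    have "hahn_exton_coeff p (a * p) k * x ^ k - a * (hahn_exton_coeff p (a * p) k * (p * x) ^ k)
       = ((1 - a * p ^ k) * hahn_exton_coeff p (a * p) k) * x ^ k"
      by (simp add: algebra_simps power_mult_distrib)
    then show ?thesis by (simp add: coeff_shift[OF assms])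
  qed
  ultimately have "(\<lambda>k. (1 - a) * (hahn_exton_coeff p a k * x ^ k))
     sums (hahn_exton_series p (a * p) x - a * hahn_exton_series p (a * p) (p * x))"
    by simp
  moreover have "(\<lambda>k. (1 - a) * (hahn_exton_coeff p a k * x ^ k)) sums ((1 - a) * hahn_exton_series p a x)"
    by (intro sums_mult series_sums assms)
  ultimately show ?thesis by (rule sums_unique2[symmetric])
qed

section \<open>The Wronskian of \<open>F(x)\<close> and \<open>F(p x)\<close>, and the spacing of zeros\<close>

definition scaled_wronskian :: "real \<Rightarrow> real \<Rightarrow> real" where
  "scaled_wronskian a x =
     hahn_exton_series_deriv p a x * hahn_exton_series p a (p * x)
     - hahn_exton_series p a x * (p * hahn_exton_series_deriv p a (p * x))"

lemma scaled_wronskian_rec: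
  assumes "a < 1"
  shows "scaled_wronskian a x
    = a * scaled_wronskian a (p * x) - p * (hahn_exton_series p a (p * x))\<^sup>2"
proof -
  let ?F = "hahn_exton_series p a" and ?F' = "hahn_exton_series_deriv p a"
  have "((\<lambda>x. (1 + a / p - p * x) * ?F (p * x) - a / p * ?F (p\<^sup>2 * x)) has_real_derivative
      ((1 + a / p - p * x) * (p * ?F' (p * x)) + (- p) * ?F (p * x) - a / p * (p\<^sup>2 * ?F' (p\<^sup>2 * x)))) (at x)"
    by (rule derivative_eq_intros DERIV_series_scaled assms refl | simp)+
  moreover have "(\<lambda>x. (1 + a / p - p * x) * ?F (p * x) - a / p * ?F (p\<^sup>2 * x)) = ?F"
    by (intro ext series_functional_equation[OF assms, symmetric])
  ultimately have F': "?F' x =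
      (1 + a / p - p * x) * (p * ?F' (p * x)) + (- p) * ?F (p * x) - a / p * (p\<^sup>2 * ?F' (p\<^sup>2 * x))"
    by (intro DERIV_unique[OF DERIV_series[OF assms]]) (simp only:)
  have F: "?F x = (1 + a / p - p * x) * ?F (p * x) - a / p * ?F (p\<^sup>2 * x)"
    by (rule series_functional_equation[OF assms])
  have *: "p * (p * x) = p\<^sup>2 * x" by (simp add: power2_eq_square)
  have mid: "a / p * (p\<^sup>2 * ?F' (p\<^sup>2 * x)) = a * p * ?F' (p\<^sup>2 * x)"
    "p * (a / p * ?F (p\<^sup>2 * x)) = a * ?F (p\<^sup>2 * x)"
    using p_pos by (simp_all add: power2_eq_square)
  have "scaled_wronskian a x =
      ((1 + a / p - p * x) * (p * ?F' (p * x)) - p * ?F (p * x) - a * p * ?F' (p\<^sup>2 * x)) * ?F (p * x)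
      - (p * ((1 + a / p - p * x) * ?F (p * x)) - a * ?F (p\<^sup>2 * x)) * ?F' (p * x)"
    unfolding scaled_wronskian_def F F' mid(1) mid(2)[symmetric]
    by (simp only: right_diff_distrib left_diff_distrib mult_ac mult_minus_left add_uminus_conv_diff)
  also have "\<dots> = a * scaled_wronskian a (p * x) - p * (?F (p * x))\<^sup>2"
    unfolding scaled_wronskian_def * by algebra
  finally show ?thesis .
qed

text \<open>Iterating the recursion pushes the argument to \<open>0\<close>, where the Wronskian is
  \<open>(1 - p) F'(0) < 0\<close>; each iteration only subtracts squares.\<close>

lemma scaled_wronskian_neg:
  assumes "0 < a" "a < 1"
  shows "scaled_wronskian a x < 0"
proof -
  have step: "scaled_wronskian a y < 0" if "scaled_wronskian a (p * y) < 0" for y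
  proof -
    have "a * scaled_wronskian a (p * y) < 0"
      using that assms by (simp add: mult_pos_neg)
    moreover have "p * (hahn_exton_series p a (p * y))\<^sup>2 \<ge> 0" using p_pos by simp
    ultimately show ?thesis using scaled_wronskian_rec[OF assms(2), of y] by linarith
  qed
  have descend: "scaled_wronskian a x < 0" if "scaled_wronskian a (p ^ n * x) < 0" for n
    using that by (induction n) (auto simp: mult.assoc intro: step)
  have cont: "isCont (\<lambda>y. scaled_wronskian a y) 0"
    unfolding scaled_wronskian_def[abs_def]
    by (intro continuous_intros isCont_o2[OF _ isCont_series_deriv[OF assms(2)]]
          isCont_o2[OF _ DERIV_isCont[OF DERIV_series[OF assms(2)]]])
  have "hahn_exton_coeff p a 1 < 0"
    using qpoch_pos[OF assms(2), of 1] qpoch_pos[OF p_less_1, of 1] p_pos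
    by (simp add: hahn_exton_coeff_def)
  then have "scaled_wronskian a 0 < 0"
    using p_less_1 by (simp add: scaled_wronskian_def series_deriv_0)
  moreover have "(\<lambda>n. p ^ n * x) \<longlonglongrightarrow> 0 * x"
    using p_pos p_less_1 by (intro tendsto_intros LIMSEQ_power_zero) auto
  then have "(\<lambda>n. scaled_wronskian a (p ^ n * x)) \<longlonglongrightarrow> scaled_wronskian a 0"
    using isCont_tendsto_compose[OF cont] by simp
  ultimately have "eventually (\<lambda>n. scaled_wronskian a (p ^ n * x) < 0) sequentially"
    by (rule order_tendstoD(2)[rotated])
  then obtain n where "scaled_wronskian a (p ^ n * x) < 0"
    by (auto simp: eventually_sequentially)
  then show ?thesis by (rule descend)
qed

text \<open>Rolle's argument for \<open>F(x) / F(p x)\<close>, whose derivative is the Wronskian over \<open>F(p x)\<^sup>2\<close>. At the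
  end points, the Wronskian being nonzero excludes a common zero of \<open>F(x)\<close> and \<open>F(p x)\<close>.\<close>

lemma series_scaled_zero_between:
  assumes "0 < a" "a < 1" "u < v"
    and "hahn_exton_series p a u = 0" "hahn_exton_series p a v = 0"
  shows "\<exists>w\<in>{u<..<v}. hahn_exton_series p a (p * w) = 0"
proof (rule ccontr)
  let ?F = "hahn_exton_series p a" and ?F' = "hahn_exton_series_deriv p a"
  assume none: "\<not> (\<exists>w\<in>{u<..<v}. ?F (p * w) = 0)"
  have end_nz: "?F (p * w) \<noteq> 0" if "?F w = 0" for w
    using scaled_wronskian_neg[OF assms(1,2), of w] that by (auto simp: scaled_wronskian_def)
  have nz: "?F (p * w) \<noteq> 0" if "u \<le> w" "w \<le> v" for w
    using none that end_nz assms(4,5) by (cases "w = u"; cases "w = v") auto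
  let ?R = "\<lambda>x. ?F x / ?F (p * x)"
  have der: "(?R has_real_derivative scaled_wronskian a w / (?F (p * w) * ?F (p * w))) (at w)"
    if "u \<le> w" "w \<le> v" for w
    unfolding scaled_wronskian_def
    by (rule DERIV_divide[OF DERIV_series DERIV_series_scaled nz]) (use assms that in auto)
  have "?R v < ?R u"
  proof (rule DERIV_neg_imp_decreasing[OF \<open>u < v\<close>])
    fix w assume w: "u \<le> w" "w \<le> v"
    have "?F (p * w) * ?F (p * w) > 0"
      using nz[OF w] by (metis not_real_square_gt_zero)
    then show "\<exists>y. DERIV ?R w :> y \<and> y < 0"
      using der[OF w] divide_neg_pos[OF scaled_wronskian_neg[OF assms(1,2), of w]] by blast
  qed
  then show False using assms(4,5) by simp
qed

section \<open>Counting zeros: monotonicity in the parameter\<close>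

text \<open>With \<open>G = F\<^bsub>ap\<^esub>\<close>, zeros of \<open>F\<^sub>a\<close> are the points where \<open>G(x) / G(p x)\<close> equals \<open>a\<close>. Going left from a
  zero \<open>y\<close> of \<open>G\<close>, this quotient rises from \<open>0\<close>, either to \<open>1\<close> at the origin or to infinity at the
  nearest zero \<open>t\<close> of \<open>G(p x)\<close>; in both cases it passes \<open>a < 1\<close>. The proof follows the sign of
  \<open>H(x) = G(x) - a G(p x)\<close>, which stays finite at \<open>t\<close>. The last conclusion keeps the zeros assigned to
  different \<open>y\<close> apart.\<close>

lemma interlacing_zero:
  assumes "0 < a" "a < 1" "0 < y" and y: "hahn_exton_series p (a * p) y = 0"
  obtains w where "0 < w" "w < y" "hahn_exton_series p a w = 0"
    "\<And>u. w \<le> u \<Longrightarrow> u < y \<Longrightarrow> hahn_exton_series p (a * p) u \<noteq> 0"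
proof -
  let ?G = "hahn_exton_series p (a * p)" and ?G' = "hahn_exton_series_deriv p (a * p)"
  have ap: "0 < a * p" "a * p < 1"
    using assms p_pos qpoch_factor_pos[OF assms(2), of 1] by auto
  define H where "H x = ?G x - a * ?G (p * x)" for x
  have H: "hahn_exton_series p a x = 0 \<longleftrightarrow> H x = 0" for x
    using series_shift_parameter[OF assms(2), of x] assms(2) unfolding H_def
    by (metis diff_gt_0_iff_gt less_irrefl mult_eq_0_iff)
  have contH: "continuous_on S H" for S
    unfolding H_def[abs_def]
    by (intro continuous_intros continuous_on_series continuous_on_series_scaled ap)
  have Gy: "?G (p * y) \<noteq> 0"
    using scaled_wronskian_neg[OF ap, of y] y by (auto simp: scaled_wronskian_def)
  have Hy: "H y = - a * ?G (p * y)" using y by (simp add: H_def)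
  \<comment> \<open>\<open>t\<close> will be the last zero of \<open>G(p x)\<close> before \<open>y\<close>, or \<open>0\<close> if there is none.\<close>
  have "\<exists>t. 0 \<le> t \<and> t < y \<and> H t * H y < 0 \<and> (\<forall>x. t < x \<and> x \<le> y \<longrightarrow> ?G (p * x) \<noteq> 0)"
  proof (cases "\<exists>x. 0 \<le> x \<and> x \<le> y \<and> ?G (p * x) = 0")
    case False
    have "?G (p * y) > 0"
    proof (rule ccontr)
      assume "\<not> ?thesis"
      then have "\<exists>x\<ge>0. x \<le> y \<and> ?G (p * x) = 0"
        using \<open>0 < y\<close> by (intro IVT2' continuous_on_series_scaled ap) auto
      with False show False by blast
    qed
    then have "H 0 * H y < 0"
      using assms by (simp add: H_def Hy mult_pos_neg)
    with False \<open>0 < y\<close> show ?thesis by (intro exI[of _ 0]) auto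
  next
    case True
    let ?Z = "{0..y} \<inter> (\<lambda>x. ?G (p * x)) -` {0}"
    have "closed ?Z"
      by (intro continuous_closed_preimage continuous_on_series_scaled ap) auto
    then have "compact ?Z"
      by (simp add: compact_eq_bounded_closed bounded_Int)
    then obtain t where t: "t \<in> ?Z" "\<And>x. x \<in> ?Z \<Longrightarrow> x \<le> t"
      using True compact_attains_sup[of ?Z] by (metis Int_iff atLeastAtMost_iff empty_iff singleton_iff vimage_eq)
    have nz: "?G (p * x) \<noteq> 0" if "t < x" "x \<le> y" for x
      using t(2)[of x] that t(1) by auto
    have Gt: "?G (p * t) = 0" "0 \<le> t" using t(1) by auto
    have "t < y" using t(1) Gy by (cases "t = y") auto
    have Wt: "?G t * ?G' (p * t) > 0"
    proof -
      have "0 < p * (?G t * ?G' (p * t))"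
        using scaled_wronskian_neg[OF ap, of t] unfolding scaled_wronskian_def Gt(1)
        by (simp only: mult_zero_right diff_0 neg_less_0_iff_less mult.left_commute)
      then show ?thesis using p_pos by (simp only: zero_less_mult_pos)
    qed
    \<comment> \<open>\<open>G(p x)\<close> leaves its zero \<open>t\<close> with the sign of \<open>G(t)\<close>, and keeps it up to \<open>y\<close>.\<close>
    \<comment> \<open>The multiplier \<open>s\<close>, later \<open>G(t)\<close>, treats both signs at once.\<close>
    have sgn: "0 < s * ?G (p * y)" if s: "0 < s * ?G' (p * t)" for s
    proof -
      have d: "((\<lambda>x. s * ?G (p * x)) has_real_derivative s * (p * ?G' (p * t))) (at t)"
        by (intro DERIV_cmult DERIV_series_scaled ap)
      have "0 < s * (p * ?G' (p * t))" using mult_pos_pos[OF p_pos s] by (simp only: mult.left_commute)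
      from DERIV_pos_inc_right[OF d this] obtain e where e: "e > 0"
        "\<And>h. 0 < h \<Longrightarrow> h < e \<Longrightarrow> 0 < s * ?G (p * (t + h))"
        using Gt by auto
      define h where "h = min (e / 2) (y - t)"
      have h: "0 < h" "h < e" "t + h \<le> y" using e \<open>t < y\<close> by (auto simp: h_def)
      show ?thesis
      proof (rule ccontr)
        assume "\<not> ?thesis"
        then have "\<exists>x\<ge>t + h. x \<le> y \<and> s * ?G (p * x) = 0"
          using e(2)[OF h(1,2)] h(3)
          by (intro IVT2' continuous_intros continuous_on_series_scaled ap) auto
        then obtain x where x: "t + h \<le> x" "x \<le> y" "s * ?G (p * x) = 0" by blast
        then have "t < x" using h(1) by linarith
        moreover have "s \<noteq> 0" using s by auto
        ultimately show False using nz[of x] x by simp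
      qed
    qed
    have "0 < ?G t * ?G (p * y)" by (rule sgn[OF Wt])
    then have "a * (?G t * ?G (p * y)) > 0" using assms by simp
    moreover have "H t * H y = - (a * (?G t * ?G (p * y)))"
      unfolding Hy using Gt by (simp add: H_def)
    ultimately have "H t * H y < 0" by linarith
    with \<open>t < y\<close> Gt nz show ?thesis by blast
  qed
  then obtain t where t: "0 \<le> t" "t < y" "H t * H y < 0"
    "\<And>x. t < x \<Longrightarrow> x \<le> y \<Longrightarrow> ?G (p * x) \<noteq> 0" by blast
  have "\<exists>w\<ge>t. w \<le> y \<and> H w = 0"
  proof (cases "H t < 0")
    case True
    then show ?thesis
      using t by (intro IVT' contH) (auto simp: mult_less_0_iff)
  next
    case False
    then show ?thesis
      using t by (intro IVT2' contH) (auto simp: mult_less_0_iff)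
  qed
  then obtain w where w: "t \<le> w" "w \<le> y" "H w = 0" by blast
  have "w \<noteq> t" "w \<noteq> y" using w(3) t(3) by auto
  with w have w': "t < w" "w < y" by auto
  have "?G u \<noteq> 0" if "w \<le> u" "u < y" for u
  proof
    assume "?G u = 0"
    from series_scaled_zero_between[OF ap \<open>u < y\<close> this y]
    obtain v where "u < v" "v < y" "?G (p * v) = 0" by auto
    then show False using t(4)[of v] that w' by auto
  qed
  with w' w(3) t(1) show ?thesis by (intro that[of w]) (auto simp: H)
qed

definition has_zeros_below :: "real \<Rightarrow> nat \<Rightarrow> real \<Rightarrow> bool" where
  "has_zeros_below a n X \<longleftrightarrow>
     (\<exists>S. finite S \<and> card S = n \<and> S \<subseteq> {x. 0 < x \<and> x < X \<and> hahn_exton_series p a x = 0})"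

lemma has_zeros_below_shift:
  assumes "0 < a" "a < 1" "has_zeros_below (a * p) n X"
  shows "has_zeros_below a n X"
proof -
  let ?G = "hahn_exton_series p (a * p)"
  obtain S where S: "finite S" "card S = n"
    "S \<subseteq> {x. 0 < x \<and> x < X \<and> ?G x = 0}"
    using assms(3) by (auto simp: has_zeros_below_def)
  have "\<forall>y\<in>S. \<exists>w. 0 < w \<and> w < y \<and> hahn_exton_series p a w = 0 \<and>
          (\<forall>u. w \<le> u \<and> u < y \<longrightarrow> ?G u \<noteq> 0)"
  proof
    fix y assume "y \<in> S"
    then have "0 < y" "?G y = 0" using S(3) by auto
    from interlacing_zero[OF assms(1,2) this] show "\<exists>w. 0 < w \<and> w < y \<and> hahn_exton_series p a w = 0 \<and>
          (\<forall>u. w \<le> u \<and> u < y \<longrightarrow> ?G u \<noteq> 0)" by metis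
  qed
  then obtain f where f: "\<And>y. y \<in> S \<Longrightarrow> 0 < f y \<and> f y < y \<and> hahn_exton_series p a (f y) = 0 \<and>
          (\<forall>u. f y \<le> u \<and> u < y \<longrightarrow> ?G u \<noteq> 0)" by metis
  have less: "f y < f z" if "y \<in> S" "z \<in> S" "y < z" for y z
  proof -
    have "?G y = 0" using S(3) that by auto
    then have "y < f z" using f[OF that(2)] that(3) by (meson not_le)
    then show ?thesis using f[OF that(1)] by linarith
  qed
  have "inj_on f S"
    by (intro linorder_inj_onI) (use less in fastforce)+
  then have "card (f ` S) = n" using S by (simp add: card_image)
  moreover have "f ` S \<subseteq> {x. 0 < x \<and> x < X \<and> hahn_exton_series p a x = 0}"
    using f S(3) by fastforce
  ultimately show ?thesis using S(1) unfolding has_zeros_below_def by blast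
qed

lemma has_zeros_below_shift_power:
  assumes "0 < a" "a < 1" "has_zeros_below (a * p ^ m) n X"
  shows "has_zeros_below a n X"
  using assms(3)
proof (induction m)
  case (Suc m)
  have "0 < a * p ^ m" "a * p ^ m < 1"
    using assms p_pos qpoch_factor_pos[OF assms(2), of m] by auto
  then show ?case
    using Suc has_zeros_below_shift[of "a * p ^ m" n X] by (simp add: mult_ac)
qed simp

section \<open>The limit of small parameter\<close>

text \<open>At \<open>a = 0\<close> the functional equation is \<open>F\<^sub>0(x) = (1 - p x) F\<^sub>0(p x)\<close>, so the sign of \<open>F\<^sub>0\<close> can be
  transported to and from a neighbourhood of the origin, where \<open>F\<^sub>0\<close> is close to \<open>1\<close>.\<close>

lemma series_zero_parameter_pos:
  assumes "0 \<le> x" "p * x < 1"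
  shows "0 < hahn_exton_series p 0 x"
proof -
  let ?F = "hahn_exton_series p 0"
  have step: "?F y > 0" if "0 \<le> y" "p * y < 1" "?F (p * y) > 0" for y
    using series_functional_equation[of 0 y] that by simp
  have small: "0 \<le> p ^ n * x \<and> p * (p ^ n * x) < 1" for n
  proof -
    have "p ^ n * (p * x) \<le> 1 * (p * x)"
      using assms p_pos p_less_1 by (intro mult_right_mono power_le_one) auto
    moreover have "p * (p ^ n * x) = p ^ n * (p * x)" by simp
    moreover have "0 \<le> p ^ n * x" using assms p_pos by simp
    ultimately show ?thesis using assms(2) by linarith
  qed
  have descend: "?F x > 0" if "?F (p ^ n * x) > 0" for n
    using that
  proof (induction n)
    case (Suc n)
    then show ?case using step[of "p ^ n * x"] small[of n] by (simp add: mult_ac)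
  qed simp
  have "(\<lambda>n. p ^ n * x) \<longlonglongrightarrow> 0 * x"
    using p_pos p_less_1 by (intro tendsto_intros LIMSEQ_power_zero) auto
  then have "(\<lambda>n. ?F (p ^ n * x)) \<longlonglongrightarrow> ?F 0"
    using isCont_tendsto_compose[OF DERIV_isCont[OF DERIV_series[of 0 0]]] by simp
  then have "eventually (\<lambda>n. ?F (p ^ n * x) > 0) sequentially"
    by (rule order_tendstoD(1)) simp
  then obtain n where "?F (p ^ n * x) > 0" by (auto simp: eventually_sequentially)
  then show ?thesis by (rule descend)
qed

lemma series_zero_parameter_sign:
  assumes "1 < s" "p * s < 1"
  shows "0 < (-1) ^ i * hahn_exton_series p 0 (s / p ^ i)"
proof (induction i)
  case 0
  then show ?case using series_zero_parameter_pos[of s] assms by simp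
next
  case (Suc i)
  have "s / p ^ i > 1"
  proof -
    have "p ^ i \<le> 1" "0 < p ^ i" using p_pos p_less_1 by (auto intro: power_le_one)
    then show ?thesis using assms by (simp add: field_simps)
  qed
  moreover have "hahn_exton_series p 0 (s / p ^ Suc i)
      = (1 - s / p ^ i) * hahn_exton_series p 0 (s / p ^ i)"
    using series_functional_equation[of 0 "s / p ^ Suc i"] p_pos by simp
  then have "(-1) ^ Suc i * hahn_exton_series p 0 (s / p ^ Suc i)
      = (s / p ^ i - 1) * ((-1) ^ i * hahn_exton_series p 0 (s / p ^ i))"
    by (simp only: power_Suc) (simp add: left_diff_distrib right_diff_distrib)
  ultimately show ?case using Suc by simp
qed

text \<open>The coefficients grow in absolute value with the parameter, so on \<open>[0, a]\<close> the series is dominated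
  by its value at \<open>a\<close> and depends continuously on the parameter.\<close>

lemma series_parameter_tendsto_0:
  assumes "0 < a" "a < 1"
  shows "(\<lambda>m. hahn_exton_series p (a * p ^ m) x) \<longlonglongrightarrow> hahn_exton_series p 0 x"
proof -
  have mono: "qpoch a p k \<le> qpoch b p k" if "0 \<le> b" "b \<le> a" for b k
    unfolding qpoch_def
    using that assms p_pos qpoch_factor_pos[OF assms(2)]
    by (intro prod_mono) (auto intro!: mult_right_mono less_imp_le)
  have unif: "uniform_limit {0..a} (\<lambda>n b. \<Sum>k<n. hahn_exton_coeff p b k * x ^ k)
      (\<lambda>b. \<Sum>k. hahn_exton_coeff p b k * x ^ k) sequentially"
  proof (rule Weierstrass_m_test)
    fix k b assume b: "b \<in> {0..a}"
    have "\<bar>hahn_exton_coeff p b k\<bar> \<le> \<bar>hahn_exton_coeff p a k\<bar>"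
      unfolding hahn_exton_coeff_def
      using mono[of b k] b qpoch_pos[OF assms(2), of k] qpoch_pos[OF p_less_1, of k] p_pos
      by (auto simp: abs_mult intro!: divide_left_mono mult_right_mono)
    then show "norm (hahn_exton_coeff p b k * x ^ k) \<le> \<bar>hahn_exton_coeff p a k * x ^ k\<bar>"
      by (simp add: abs_mult mult_right_mono)
  next
    show "summable (\<lambda>k. \<bar>hahn_exton_coeff p a k * x ^ k\<bar>)"
      using powser_insidea[OF summable_series[OF assms(2), of "\<bar>x\<bar> + 1"], of x] by simp
  qed
  have "continuous_on {0..a} (\<lambda>b. hahn_exton_series p b x)"
    unfolding hahn_exton_series_def
  proof (rule uniform_limit_theorem[OF _ unif])
    have "continuous_on {0..a} (\<lambda>b. hahn_exton_coeff p b k)" for k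
    proof -
      have "qpoch b p k \<noteq> 0" if "b \<in> {0..a}" for b
        using qpoch_pos[of b k] that assms by auto
      then have nz: "qpoch b p k * qpoch p p k \<noteq> 0" if "b \<in> {0..a}" for b
        using qpoch_pos[OF p_less_1, of k] that by fastforce
      have "continuous_on {0..a} (\<lambda>b. qpoch b p k)"
        unfolding qpoch_def by (intro continuous_intros)
      with nz show ?thesis
        unfolding hahn_exton_coeff_def
        by (intro continuous_on_divide continuous_on_mult continuous_on_const) auto
    qed
    then show "\<forall>\<^sub>F n in sequentially. continuous_on {0..a} (\<lambda>b. \<Sum>k<n. hahn_exton_coeff p b k * x ^ k)"
      by (intro always_eventually allI continuous_intros)
  qed simp
  moreover have "(\<lambda>m. a * p ^ m) \<longlonglongrightarrow> a * 0"
    using p_pos p_less_1 by (intro tendsto_intros LIMSEQ_power_zero) auto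
  moreover have "a * p ^ m \<in> {0..a}" for m
    using assms p_pos p_less_1 by (auto simp: mult_left_le power_le_one)
  ultimately show ?thesis
    using continuous_on_tendsto_compose[of "{0..a}" "\<lambda>b. hahn_exton_series p b x" "\<lambda>m. a * p ^ m" 0 sequentially]
      assms by simp
qed

text \<open>The sample points \<open>s / p\<^sup>i\<close> separate the zeros of \<open>F\<^sub>0\<close>, and its alternating signs at finitely many
  of them persist for a small positive parameter.\<close>

lemma has_zeros_below_geometric:
  assumes "0 < a" "a < 1" "1 < s" "p * s < 1"
  shows "has_zeros_below a k (s / p ^ k)"
proof -
  define X where "X i = s / p ^ i" for i
  have "\<forall>\<^sub>F m in sequentially. \<forall>i\<in>{..k}. 0 < (-1) ^ i * hahn_exton_series p (a * p ^ m) (X i)"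
  proof (intro eventually_ball_finite ballI)
    fix i
    have "(\<lambda>m. (-1) ^ i * hahn_exton_series p (a * p ^ m) (X i))
            \<longlonglongrightarrow> (-1) ^ i * hahn_exton_series p 0 (X i)"
      by (intro tendsto_intros series_parameter_tendsto_0 assms)
    then show "\<forall>\<^sub>F m in sequentially. 0 < (-1) ^ i * hahn_exton_series p (a * p ^ m) (X i)"
      by (rule order_tendstoD(1)) (simp add: X_def series_zero_parameter_sign assms)
  qed simp
  then obtain m where m: "\<And>i. i \<le> k \<Longrightarrow> 0 < (-1) ^ i * hahn_exton_series p (a * p ^ m) (X i)"
    by (auto simp: eventually_sequentially)
  let ?G = "hahn_exton_series p (a * p ^ m)"
  have ap: "a * p ^ m < 1" using qpoch_factor_pos[OF assms(2), of m] by simp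
  have X_less: "X i < X (Suc i)" for i
    using assms p_pos p_less_1 by (simp add: X_def field_simps)
  have X_pos: "X i > 0" for i using assms p_pos by (simp add: X_def)
  have "has_zeros_below (a * p ^ m) i (X i)" if "i \<le> k" for i
    using that
  proof (induction i)
    case 0
    then show ?case by (auto simp: has_zeros_below_def)
  next
    case (Suc i)
    then obtain S where S: "finite S" "card S = i" "S \<subseteq> {x. 0 < x \<and> x < X i \<and> ?G x = 0}"
      by (auto simp: has_zeros_below_def)
    have sg: "0 < (-1) ^ i * ?G (X i)" "(-1) ^ i * ?G (X (Suc i)) < 0"
      using m[of i] m[of "Suc i"] Suc.prems by auto
    have "\<exists>x\<ge>X i. x \<le> X (Suc i) \<and> (-1) ^ i * ?G x = 0"
      using sg X_less[of i] by (intro IVT2' continuous_intros continuous_on_series ap) auto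
    then obtain x where x: "X i \<le> x" "x \<le> X (Suc i)" "?G x = 0" by auto
    with sg have "x \<noteq> X (Suc i)" by auto
    then have "insert x S \<subseteq> {x. 0 < x \<and> x < X (Suc i) \<and> ?G x = 0}"
      using x S(3) X_less[of i] X_pos[of i] by auto
    moreover have "x \<notin> S" using S(3) x by auto
    ultimately show ?case
      using S unfolding has_zeros_below_def by (intro exI[of _ "insert x S"]) auto
  qed
  from has_zeros_below_shift_power[OF assms(1,2) this[OF order_refl]]
  show ?thesis by (simp add: X_def)
qed

end

section \<open>Zeros of the Bessel function\<close>

lemma base_parameters:
  fixes q \<nu> :: real
  assumes "0 < q" "q < 1" "\<nu> > -1"
  shows "0 < q\<^sup>2" "q\<^sup>2 < 1" "0 < q powr (2 * (\<nu> + 1))" "q powr (2 * (\<nu> + 1)) < 1"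
proof -
  show "q\<^sup>2 < 1" using power_strict_mono[of q 1 2] assms by simp
  show "q powr (2 * (\<nu> + 1)) < 1"
    using powr_less_mono2[of "2 * (\<nu> + 1)" q 1] assms by simp
qed (use assms in auto)

lemma hahn_exton_J_eq_0_iff:
  fixes q \<nu> z :: real
  assumes "0 < q" "q < 1" "\<nu> > -1" "0 < z"
  shows "hahn_exton_J \<nu> q z = 0 \<longleftrightarrow> hahn_exton_series (q\<^sup>2) (q powr (2 * (\<nu> + 1))) (z\<^sup>2) = 0"
proof -
  let ?a = "q powr (2 * (\<nu> + 1))"
  have a: "0 < ?a" "?a < 1" and p: "0 < q\<^sup>2" "q\<^sup>2 < 1"
    using base_parameters assms(1-3) by auto
  have "(-1) ^ k * (q ^ (k * (k + 1)) / (qpoch ?a (q\<^sup>2) k * qpoch (q\<^sup>2) (q\<^sup>2) k)) * z ^ (2 * k)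
      = hahn_exton_coeff (q\<^sup>2) ?a k * (z\<^sup>2) ^ k" for k
  proof -
    have "2 * (k * (k + 1) div 2) = k * (k + 1)"
      by (rule dvd_mult_div_cancel) simp
    then have "(q\<^sup>2) ^ (k * (k + 1) div 2) = q ^ (k * (k + 1))"
      by (simp only: power_mult[symmetric])
    then show ?thesis
      by (simp add: hahn_exton_coeff_def power_mult)
  qed
  then have "hahn_exton_J \<nu> q z
      = z powr \<nu> * (qpoch_inf ?a (q\<^sup>2) / qpoch_inf (q\<^sup>2) (q\<^sup>2)) * hahn_exton_series (q\<^sup>2) ?a (z\<^sup>2)"
    by (simp only: hahn_exton_J_def hahn_exton_series_def)
  moreover have "qpoch_inf ?a (q\<^sup>2) > 0" "qpoch_inf (q\<^sup>2) (q\<^sup>2) > 0"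
    using a p by (auto intro: qpoch_inf_pos)
  ultimately show ?thesis using \<open>0 < z\<close> by auto
qed

text \<open>The zero that lies in \<open>(p x\<^bsub>n+1\<^esub>, p x\<^bsub>n+2\<^esub>)\<close> exceeds \<open>x\<^sub>n\<close> by the induction hypothesis, hence is at
  least \<open>x\<^bsub>n+1\<^esub>\<close>.\<close>

lemma enumerated_zeros_spacing:
  fixes p a :: real and x :: "nat \<Rightarrow> real"
  assumes "0 < p" "p < 1" "0 < a" "a < 1"
    and mono: "strict_mono_on {1..} x"
    and zeros: "x ` {1..} = {t. 0 < t \<and> hahn_exton_series p a t = 0}"
    and "1 \<le> n"
  shows "x n < p * x (Suc n)"
proof -
  have between: "\<exists>i\<ge>1. p * x m < x i \<and> x i < p * x (Suc m)" if "1 \<le> m" for m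
  proof -
    have "x m \<in> x ` {1..}" "x (Suc m) \<in> x ` {1..}" using that by auto
    then have z: "hahn_exton_series p a (x m) = 0" "hahn_exton_series p a (x (Suc m)) = 0" "0 < x m"
      unfolding zeros by auto
    have "x m < x (Suc m)"
      using that by (intro strict_mono_onD[OF mono]) auto
    from series_scaled_zero_between[OF assms(1-4) this z(1,2)]
    obtain w where w: "x m < w" "w < x (Suc m)" "hahn_exton_series p a (p * w) = 0" by auto
    have "p * w > 0" using w z(3) assms(1) by auto
    then have "p * w \<in> x ` {1..}" unfolding zeros using w by auto
    then obtain i where "i \<ge> 1" "x i = p * w" by auto
    then show ?thesis using w assms(1) by auto
  qed
  have le: "x i \<le> x i'" if "1 \<le> i" "i \<le> i'" for i i'
    using that by (intro monotone_onD[OF strict_mono_on_imp_mono_on[OF mono]]) auto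
  show ?thesis
    using \<open>1 \<le> n\<close>
  proof (induction n rule: dec_induct)
    case base
    from between[of 1] obtain i where "i \<ge> 1" "x i < p * x (Suc 1)" by auto
    then show ?case using le[of 1 i] by simp
  next
    case (step n)
    from between[of "Suc n"] obtain i where i: "i \<ge> 1" "p * x (Suc n) < x i" "x i < p * x (Suc (Suc n))"
      by auto
    have "x n < x i" using step i by linarith
    then have "\<not> i \<le> n" using le[of i n] i(1) by linarith
    then have "x (Suc n) \<le> x i" using le[of "Suc n" i] by simp
    with i show ?case by linarith
  qed
qed

lemma enumerated_zeros_upper_bound:
  fixes p a :: real and x :: "nat \<Rightarrow> real"
  assumes "0 < p" "p < 1" "0 < a" "a < 1"
    and mono: "strict_mono_on {1..} x"
    and zeros: "x ` {1..} = {t. 0 < t \<and> hahn_exton_series p a t = 0}"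
    and "1 \<le> k"
  shows "x k \<le> 1 / p ^ k"
proof -
  have "p ^ k * x k \<le> s" if s: "1 < s" "s < 1 / p" for s
  proof -
    have "p * s < 1" using s(2) assms(1) by (simp add: field_simps)
    from has_zeros_below_geometric[OF assms(1-4) s(1) this, of k]
    obtain S where S: "finite S" "card S = k"
      "S \<subseteq> {t. 0 < t \<and> t < s / p ^ k \<and> hahn_exton_series p a t = 0}"
      using has_zeros_below_def[OF assms(1,2)] by auto
    have "x k < s / p ^ k"
    proof (rule ccontr)
      assume "\<not> ?thesis"
      have "S \<subseteq> x ` {1..<k}"
      proof
        fix t assume "t \<in> S"
        then have "t \<in> x ` {1..}" "t < s / p ^ k" unfolding zeros using S(3) by auto
        then obtain i where i: "i \<ge> 1" "t = x i" "x i < x k"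
          using \<open>\<not> x k < s / p ^ k\<close> by auto
        then have "i < k"
          using \<open>1 \<le> k\<close> monotone_onD[OF strict_mono_on_imp_mono_on[OF mono], of k i]
          by (cases "i < k") auto
        with i show "t \<in> x ` {1..<k}" by auto
      qed
      then have "card S \<le> card {1..<k}"
        by (rule surj_card_le[rotated]) simp
      then show False using S(2) \<open>1 \<le> k\<close> by simp
    qed
    then show ?thesis using assms(1) by (simp add: field_simps)
  qed
  then have "p ^ k * x k \<le> 1"
    using assms(1,2) by (intro dense_ge_bounded[of 1 "1 / p"]) auto
  then show ?thesis using assms(1) by (simp add: field_simps)
qed

theorem theorem3p6:
  fixes q \<nu> :: real and j :: "nat \<Rightarrow> real"
  assumes "0 < q" and "q < 1" and "\<nu> > -1"
    and "strict_mono_on {1..} j"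
    and "j ` {1..} = {z. 0 < z \<and> hahn_exton_J \<nu> q z = 0}"
  shows "\<forall>\<^sub>F k in sequentially.
           j (k - 1) < q * j k \<and> q * j k < q powi (- int k + 1)"
proof -
  let ?p = "q\<^sup>2" and ?a = "q powr (2 * (\<nu> + 1))"
  define x where "x i = (j i)\<^sup>2" for i
  have pa: "0 < ?p" "?p < 1" "0 < ?a" "?a < 1"
    using base_parameters[OF assms(1-3)] by blast+
  have j_pos: "0 < j i" if "1 \<le> i" for i
  proof -
    have "j i \<in> j ` {1..}" using that by simp
    then show ?thesis unfolding assms(5) by simp
  qed
  have mono: "strict_mono_on {1..} x"
  proof (rule strict_mono_onI)
    fix r s :: nat assume "r \<in> {1..}" "s \<in> {1..}" "r < s"
    then show "x r < x s"
      using strict_mono_onD[OF assms(4), of r s] j_pos[of r] unfolding x_def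
      by (intro power_strict_mono) auto
  qed
  have zeros: "x ` {1..} = {t. 0 < t \<and> hahn_exton_series ?p ?a t = 0}"
  proof -
    have "x ` {1..} = (\<lambda>z. z\<^sup>2) ` (j ` {1..})"
      by (simp add: image_image x_def)
    also have "\<dots> = {t. 0 < t \<and> hahn_exton_series ?p ?a t = 0}"
      unfolding assms(5)
    proof (intro equalityI subsetI)
      fix t assume "t \<in> {t. 0 < t \<and> hahn_exton_series ?p ?a t = 0}"
      then have "t = (sqrt t)\<^sup>2" "0 < sqrt t" "hahn_exton_series ?p ?a ((sqrt t)\<^sup>2) = 0" by auto
      then show "t \<in> (\<lambda>z. z\<^sup>2) ` {z. 0 < z \<and> hahn_exton_J \<nu> q z = 0}"
        using hahn_exton_J_eq_0_iff[OF assms(1-3), of "sqrt t"] by blast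
    qed (auto simp: hahn_exton_J_eq_0_iff[OF assms(1-3)])
    finally show ?thesis .
  qed
  have "j (k - 1) < q * j k \<and> q * j k < q powi (- int k + 1)" if "2 \<le> k" for k
  proof
    have "(j (k - 1))\<^sup>2 < (q * j k)\<^sup>2"
      using enumerated_zeros_spacing[OF pa mono zeros, of "k - 1"] that
      by (simp add: x_def power_mult_distrib)
    then show "j (k - 1) < q * j k"
      by (rule power2_less_imp_less) (use j_pos[of k] assms that in simp)
    \<comment> \<open>The spacing at \<open>k\<close> makes the weak bound at \<open>k + 1\<close> strict at \<open>k\<close>.\<close>
    have "x k < ?p * x (Suc k)"
      using enumerated_zeros_spacing[OF pa mono zeros, of k] that by simp
    also have "\<dots> \<le> ?p * (1 / ?p ^ Suc k)"
      using enumerated_zeros_upper_bound[OF pa mono zeros, of "Suc k"] pa by (intro mult_left_mono) auto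
    also have "\<dots> = (1 / q ^ k)\<^sup>2"
      using assms by (simp add: power_divide power_mult[symmetric] mult.commute)
    finally have "j k < 1 / q ^ k"
      unfolding x_def by (rule power2_less_imp_less) (use assms in simp)
    then have "q * j k < q * (1 / q ^ k)"
      using assms by (intro mult_strict_left_mono)
    also have "\<dots> = q powi (- int k + 1)"
    proof -
      have "q powi (- int k + 1) = q powi (- int k) * q"
        using assms(1) power_int_add[of q "- int k" 1] by simp
      then show ?thesis by (simp add: power_int_minus divide_inverse)
    qed
    finally show "q * j k < q powi (- int k + 1)" .
  qed
  then show ?thesis
    unfolding eventually_sequentially by blast
qed

end
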